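(* Let $b_n(x)=B_n(x)/n!$ be the factorially normalized Bernoulli polynomials. The following identities of functions on $[0,1)$ hold: $$b_0\circledast b_0=b_0,$$ $$b_0\circledast b_n=0\qquad(n\ge1),$$ $$b_n\circledast b_m=-b_{n+m}\qquad(n,m\ge1).$$
   Context: The Bernoulli polynomials $B_n(x)$ are defined by $\frac{\lambda e^{\lambda x}}{e^\lambda-1}=\sum_{n\ge0}\frac{B_n(x)}{n!}\lambda^n$ for $|\lambda|<2\pi$. The circle group $\mathbb{T}=\mathbb{R}/\mathbb{Z}$ is identified with $[0,1)$. For integrable $f,g$ on $[0,1)$, the circular convolution is $(f\circledast g)(u)=\int_0^1 f(v)\,g(u-v)\,dv$, where $u-v$ is taken modulo $1$ in $[0,1)$. A polynomial is regarded as a function on $\mathbb{T}$ by restriction to $[0,1)$. *)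

theory Defs
  imports "HOL-Complex_Analysis.Complex_Analysis"
begin

text \<open>
  The generating function \<open>\<lambda> e\<^bsup>\<lambda> x\<^esup> / (e\<^bsup>\<lambda>\<^esup> - 1)\<close> as a formal power series in \<open>\<lambda>\<close>. Numerator and
  denominator both have zero constant term and the denominator has nonzero linear term, so
  the quotient is a genuine quotient in the ring of formal power series.
\<close>

definition bernpoly_gf :: "'a :: field_char_0 \<Rightarrow> 'a fps" where
  "bernpoly_gf x = fps_X * fps_exp x / (fps_exp 1 - 1)"

definition bernpoly :: "nat \<Rightarrow> 'a :: field_char_0 \<Rightarrow> 'a" where
  "bernpoly n x = fact n * fps_nth (bernpoly_gf x) n"

definition bernpoly_normalized :: "nat \<Rightarrow> 'a :: field_char_0 \<Rightarrow> 'a" where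
  "bernpoly_normalized n x = bernpoly n x / fact n"

text \<open>
  Functions on the circle are represented by functions on the reals of which only the values on
  \<open>[0, 1)\<close> matter; \<open>frac\<close> reduces \<open>u - v\<close> modulo 1 to its representative in \<open>[0, 1)\<close>.
\<close>

definition circ_conv :: "(real \<Rightarrow> real) \<Rightarrow> (real \<Rightarrow> real) \<Rightarrow> real \<Rightarrow> real" where
  "circ_conv f g u = (LINT v:{0..<1}|lborel. f v * g (frac (u - v)))"

text \<open>
  The formal definition agrees with the analytic one: the series converges to the generating
  function for \<open>0 < |\<lambda>| < 2 \<pi>\<close>, the singularity at \<open>0\<close> being removable with value \<open>1\<close>.
\<close>

lemma bernpoly_gf_mult:
  "bernpoly_gf x * (fps_exp 1 - 1) = fps_X * fps_exp (x :: 'a :: field_char_0)"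
proof -
  have nz: "fps_nth (fps_exp 1 - 1 :: 'a fps) 1 \<noteq> 0"
    by simp
  have ne: "fps_exp 1 - 1 \<noteq> (0 :: 'a fps)"
    using nz by force
  have sd: "subdegree (fps_exp 1 - 1 :: 'a fps) = 1"
    using nz by (intro subdegreeI) (auto simp: less_Suc_eq)
  have "subdegree (fps_X * fps_exp x) = 1"
    by (intro subdegreeI) (auto simp: less_Suc_eq)
  hence "(fps_exp 1 - 1) dvd (fps_X * fps_exp x)"
    by (metis fps_dvd_iff ne sd order_refl subdegree_0 zero_neq_one)
  thus ?thesis
    unfolding bernpoly_gf_def by simp
qed

lemma bernpoly_of_real:
  "bernpoly n (of_real x :: complex) = of_real (bernpoly n x)"
proof -
  define F :: "complex fps" where "F = Abs_fps (\<lambda>n. of_real (fps_nth (bernpoly_gf x) n))"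
  have "F * (fps_exp 1 - 1) = fps_X * fps_exp (of_real x)"
  proof (rule fps_ext)
    fix n
    have "fps_nth (F * (fps_exp 1 - 1)) n =
            of_real (fps_nth (bernpoly_gf x * (fps_exp 1 - 1)) n)"
      unfolding fps_mult_nth by (simp add: F_def if_distrib[of of_real] cong: if_cong)
    also have "\<dots> = fps_nth (fps_X * fps_exp (of_real x)) n"
      unfolding bernpoly_gf_mult by simp
    finally show "fps_nth (F * (fps_exp 1 - 1)) n = fps_nth (fps_X * fps_exp (of_real x)) n" .
  qed
  also have "\<dots> = bernpoly_gf (of_real x) * (fps_exp 1 - 1)"
    by (simp add: bernpoly_gf_mult)
  finally have "F * (fps_exp 1 - 1) = bernpoly_gf (of_real x) * (fps_exp 1 - 1)" .
  moreover have "fps_nth (fps_exp 1 - 1 :: complex fps) 1 \<noteq> 0"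
    by simp
  hence "fps_exp 1 - 1 \<noteq> (0 :: complex fps)"
    by force
  ultimately have "F = bernpoly_gf (of_real x)"
    by simp
  thus ?thesis
    by (metis F_def bernpoly_def fps_nth_Abs_fps of_real_fact of_real_mult)
qed

lemma bernpoly_sums:
  fixes x :: real and z :: complex
  assumes "z \<noteq> 0" "norm z < 2 * pi"
  shows "(\<lambda>n. of_real (bernpoly n x) / fact n * z ^ n)
           sums (z * exp (z * of_real x) / (exp z - 1))"
proof -
  define f g :: "complex fps"
    where "f = fps_X * fps_exp (of_real x)" and "g = fps_exp 1 - 1"
  define R where "R = Min {ereal (2 * pi), fps_conv_radius f, fps_conv_radius g}"
  have rf: "fps_conv_radius f = \<infinity>"
    using fps_conv_radius_mult[of "fps_X" "fps_exp (of_real x :: complex)"]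
    unfolding f_def by simp
  have rg: "fps_conv_radius g = \<infinity>"
    using fps_conv_radius_diff[of "fps_exp (1::complex)" 1] unfolding g_def by simp
  have R: "R = ereal (2 * pi)"
    unfolding R_def rf rg by simp
  have nz: "fps_nth g 1 \<noteq> 0"
    by (simp add: g_def)
  have sd: "subdegree g = 1"
    using nz by (intro subdegreeI) (auto simp: less_Suc_eq g_def)
  have "subdegree f = 1"
    by (intro subdegreeI) (auto simp: less_Suc_eq f_def)
  hence sdf: "subdegree f \<ge> 1"
    by simp
  have eg: "eval_fps g w = exp w - 1" for w
    unfolding g_def by (subst eval_fps_diff) auto
  have ef: "eval_fps f w = w * exp (w * of_real x)" for w
    unfolding f_def by (subst eval_fps_mult) (auto simp: mult.commute)
  have nz2: "eval_fps g w \<noteq> 0" if "w \<in> eball 0 (ereal (2 * pi))" "w \<noteq> 0" for w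
  proof
    assume "eval_fps g w = 0"
    hence "exp w = 1" by (simp add: eg)
    then obtain n :: int where n: "Re w = 0" "Im w = of_int (2 * n) * pi"
      by (auto simp: exp_eq_1)
    have "norm w = 2 * pi * \<bar>of_int n\<bar>"
      using n by (simp add: cmod_def abs_mult)
    moreover have "n \<noteq> 0" using n that(2) by (auto simp: complex_eq_iff)
    hence "\<bar>real_of_int n\<bar> \<ge> 1" by linarith
    ultimately have "norm w \<ge> 2 * pi" by simp
    thus False using that(1) by simp
  qed
  have cr: "fps_conv_radius (f / g) \<ge> ereal (2 * pi)"
  proof -
    have "R \<le> fps_conv_radius (f / g)"
      unfolding R_def
      by (rule fps_conv_radius_divide) (use sd sdf nz2 rf rg in \<open>auto simp: zero_ereal_def\<close>)
    thus ?thesis by (simp add: R)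
  qed
  have z: "ereal (norm z) < fps_conv_radius (f / g)"
    by (rule less_le_trans[OF _ cr]) (use assms in simp)
  have "eval_fps (f / g) z * eval_fps g z = eval_fps (f / g * g) z"
    by (rule eval_fps_mult[symmetric]) (use z rg in auto)
  also have "f / g * g = f"
    using bernpoly_gf_mult[of "of_real x :: complex"] by (simp add: bernpoly_gf_def f_def g_def)
  finally have ev: "eval_fps (f / g) z = z * exp (z * of_real x) / (exp z - 1)"
    using nz2[of z] assms by (simp add: ef eg field_simps)
  have "(\<lambda>n. fps_nth (f / g) n * z ^ n) sums eval_fps (f / g) z"
    by (rule sums_eval_fps[OF z])
  moreover have "fps_nth (f / g) n = of_real (bernpoly n x) / fact n" for n
    unfolding bernpoly_of_real[symmetric] by (simp add: bernpoly_def bernpoly_gf_def f_def g_def)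
  ultimately show ?thesis
    by (simp add: ev)
qed

lemma bernpoly_is_poly:
  "\<exists>p. degree p \<le> n \<and> (\<forall>x :: 'a :: field_char_0. bernpoly n x = poly p x)"
proof -
  define c :: "nat \<Rightarrow> 'a" where "c i = fact n * fps_nth (bernpoly_gf 0) i / fact (n - i)" for i
  have "bernpoly_gf x = bernpoly_gf 0 * fps_exp x" for x :: 'a
  proof -
    have "bernpoly_gf x * (fps_exp 1 - 1) = bernpoly_gf 0 * fps_exp x * (fps_exp 1 - 1)"
      using bernpoly_gf_mult[of x] bernpoly_gf_mult[of "0 :: 'a"] by (simp add: mult_ac)
    moreover have "fps_nth (fps_exp 1 - 1 :: 'a fps) 1 \<noteq> 0"
      by simp
    hence "fps_exp 1 - 1 \<noteq> (0 :: 'a fps)"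
      by force
    ultimately show ?thesis by simp
  qed
  hence gf: "fps_nth (bernpoly_gf x) n = fps_nth (bernpoly_gf 0 * fps_exp x) n" for x :: 'a
    by metis
  have *: "bernpoly n x = (\<Sum>i=0..n. c i * x ^ (n - i))" for x :: 'a
    unfolding bernpoly_def gf
    by (simp only: fps_mult_nth fps_exp_nth sum_distrib_left c_def times_divide_eq_left
         times_divide_eq_right mult.assoc of_nat_fact)
  show ?thesis
    by (intro exI[of _ "\<Sum>i=0..n. monom (c i) (n - i)"]) (intro conjI allI degree_sum_le,
        auto simp: * poly_sum poly_monom intro: order.trans[OF degree_monom_le])
qed

text \<open>The integrals below exist, so the default value of the Lebesgue integral plays no role.\<close>

lemma circ_conv_integrable:
  "set_integrable lborel {0..<1}
     (\<lambda>v. bernpoly_normalized n v * bernpoly_normalized m (frac (u - v)) :: real)"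
proof -
  obtain p where p: "\<And>x :: real. bernpoly n x = poly p x" using bernpoly_is_poly by metis
  obtain q where q: "\<And>x :: real. bernpoly m x = poly q x" using bernpoly_is_poly by metis
  have eq: "bernpoly_normalized n = (\<lambda>x. poly p x / fact n)"
           "bernpoly_normalized m = (\<lambda>x. poly q x / fact m)"
    by (auto simp: bernpoly_normalized_def p q)
  have "bounded (bernpoly_normalized n ` {0..1 :: real})"
       "bounded (bernpoly_normalized m ` {0..1 :: real})"
    unfolding eq by (intro compact_imp_bounded compact_continuous_image continuous_intros; simp)+
  then obtain A B where
    AB: "\<And>v :: real. v \<in> {0..1} \<Longrightarrow> \<bar>bernpoly_normalized n v\<bar> \<le> A"
        "\<And>v :: real. v \<in> {0..1} \<Longrightarrow> \<bar>bernpoly_normalized m v\<bar> \<le> B"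
    unfolding bounded_iff by fastforce
  have [measurable]: "bernpoly_normalized n \<in> borel_measurable (borel :: real measure)"
                     "bernpoly_normalized m \<in> borel_measurable (borel :: real measure)"
    unfolding eq by (intro borel_measurable_continuous_onI continuous_intros; simp)+
  have [measurable]: "(frac :: real \<Rightarrow> real) \<in> borel_measurable borel"
    unfolding frac_def by measurable
  show ?thesis
    unfolding set_integrable_def
  proof (rule integrableI_bounded_set_indicator[where B = "A * B"])
    show "AE v in lborel. v \<in> {0..<1} \<longrightarrow>
            norm (bernpoly_normalized n v * bernpoly_normalized m (frac (u - v))) \<le> A * B"
    proof (intro AE_I2 impI)
      fix v :: real assume v: "v \<in> {0..<1}"
      have "frac (u - v) \<in> {0..1}" by (auto simp: less_imp_le frac_lt_1)
      thus "norm (bernpoly_normalized n v * bernpoly_normalized m (frac (u - v))) \<le> A * B"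
        using AB(1)[of v] AB(2)[of "frac (u - v)"] v
        by (auto simp: abs_mult intro!: mult_mono)
    qed
  qed auto
qed

end

theory Submission
  imports Defs
begin

text \<open>
  Write \<open>b\<^sub>n\<close> for \<open>bernpoly_normalized n\<close> and \<open>*\<close> for circular convolution. The \<open>b\<^sub>n\<close> form an
  Appell sequence: \<open>b\<^sub>n\<^sub>+\<^sub>1\<close> has derivative \<open>b\<^sub>n\<close>. Since the generating function satisfies
  \<open>bernpoly_gf 1 - bernpoly_gf 0 = fps_X\<close>, the jump \<open>b\<^sub>n(1) - b\<^sub>n(0)\<close> at the base point of the
  circle is \<open>1\<close> for \<open>n = 1\<close> and \<open>0\<close> for all other \<open>n\<close>.

  Integration by parts on the circle (\<open>circular_integration_by_parts\<close>) has exactly these jumps as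
  boundary terms. It shows that \<open>b\<^sub>n * b\<^sub>m\<^sub>+\<^sub>1 = b\<^sub>n\<^sub>+\<^sub>1 * b\<^sub>m\<close> for \<open>n, m \<ge> 1\<close>, and that
  \<open>b\<^sub>0 * b\<^sub>m\<^sub>+\<^sub>1 = b\<^sub>1 * b\<^sub>m + b\<^sub>m\<^sub>+\<^sub>1\<close> for \<open>m \<ge> 1\<close> (\<open>circ_conv_bernpoly_normalized_shift\<close>).
  Since \<open>b\<^sub>0 = 1\<close>, the convolution \<open>b\<^sub>0 * b\<^sub>m\<close> is the mean of \<open>b\<^sub>m\<close>, that is the jump of
  \<open>b\<^sub>m\<^sub>+\<^sub>1\<close>; it vanishes for \<open>m \<ge> 1\<close>. Hence \<open>b\<^sub>1 * b\<^sub>m = - b\<^sub>m\<^sub>+\<^sub>1\<close>, and induction on the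
  left index gives the general case.
\<close>

lemma bernpoly_normalized_eq_nth: "bernpoly_normalized n x = fps_nth (bernpoly_gf x) n"
  by (simp add: bernpoly_normalized_def bernpoly_def)

lemma fps_exp_1_minus_1_nonzero: "fps_exp 1 - 1 \<noteq> (0 :: 'a :: field_char_0 fps)"
proof
  assume "fps_exp 1 - 1 = (0 :: 'a fps)"
  hence "fps_nth (fps_exp 1 - 1 :: 'a fps) 1 = 0" by simp
  thus False by simp
qed

lemma bernpoly_gf_eq: "bernpoly_gf x = bernpoly_gf 0 * fps_exp x"
proof -
  have "bernpoly_gf x * (fps_exp 1 - 1) = bernpoly_gf 0 * fps_exp x * (fps_exp 1 - 1)"
    using bernpoly_gf_mult[of x] bernpoly_gf_mult[of "0 :: 'a"] by (simp add: mult_ac)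
  thus ?thesis using fps_exp_1_minus_1_nonzero by simp
qed

lemma bernpoly_gf_1: "bernpoly_gf 1 = bernpoly_gf 0 + (fps_X :: 'a :: field_char_0 fps)"
proof -
  have "bernpoly_gf 1 * (fps_exp 1 - 1) = (bernpoly_gf 0 + fps_X) * (fps_exp 1 - 1 :: 'a fps)"
    using bernpoly_gf_mult[of "1 :: 'a"] bernpoly_gf_mult[of "0 :: 'a"]
    by (simp add: algebra_simps)
  thus ?thesis using fps_exp_1_minus_1_nonzero by simp
qed

lemma bernpoly_normalized_jump:
  "bernpoly_normalized n 1 - bernpoly_normalized n (0 :: 'a :: field_char_0) = of_bool (n = 1)"
  by (simp add: bernpoly_normalized_eq_nth bernpoly_gf_1)

lemma bernpoly_normalized_0: "bernpoly_normalized 0 x = (1 :: 'a :: field_char_0)"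
proof -
  have "fps_nth (bernpoly_gf x * (fps_exp 1 - 1)) 1 = fps_nth (fps_X * fps_exp x) 1"
    by (simp only: bernpoly_gf_mult)
  thus ?thesis by (simp add: bernpoly_normalized_eq_nth fps_mult_nth)
qed

lemma bernpoly_normalized_altdef:
  "bernpoly_normalized n x = (\<Sum>i\<le>n. fps_nth (bernpoly_gf 0) i * x ^ (n - i) / fact (n - i))"
  unfolding bernpoly_normalized_eq_nth bernpoly_gf_eq[of x]
  by (simp add: fps_mult_nth atLeast0AtMost)

lemma has_real_derivative_bernpoly_normalized:
  "(bernpoly_normalized (Suc n) has_real_derivative bernpoly_normalized n x) (at x)"
proof -
  let ?c = "fps_nth (bernpoly_gf (0 :: real))"
  have "((\<lambda>x. ?c i * x ^ (Suc n - i) / fact (Suc n - i)) has_real_derivative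
            ?c i * x ^ (n - i) / fact (n - i)) (at x)" if "i \<le> n" for i
  proof -
    have "((\<lambda>x. a * x ^ Suc k / fact (Suc k)) has_real_derivative a * x ^ k / fact k) (at x)"
      for a :: real and k
      by (rule derivative_eq_intros refl | simp del: of_nat_Suc power_Suc)+
    thus ?thesis using that by (simp only: Suc_diff_le)
  qed
  hence "((\<lambda>x. (\<Sum>i\<le>n. ?c i * x ^ (Suc n - i) / fact (Suc n - i)) + ?c (Suc n))
            has_real_derivative (\<Sum>i\<le>n. ?c i * x ^ (n - i) / fact (n - i)) + 0) (at x)"
    by (intro DERIV_add DERIV_sum DERIV_const) auto
  moreover have "bernpoly_normalized (Suc n) =
      (\<lambda>x. (\<Sum>i\<le>n. ?c i * x ^ (Suc n - i) / fact (Suc n - i)) + ?c (Suc n))"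
    by (rule ext) (simp add: bernpoly_normalized_altdef)
  ultimately show ?thesis
    by (simp add: bernpoly_normalized_altdef[symmetric])
qed

text \<open>
  The functions \<open>F\<close> and \<open>G\<close> are differentiable on the line but need not be periodic; as functions
  on the circle they jump at the base point. The product \<open>F v * G (u - v)\<close> therefore has two jumps,
  at \<open>v = 0\<close> and at \<open>v = u\<close>, which give the boundary terms.
\<close>

lemma circular_integration_by_parts:
  fixes f F g G :: "real \<Rightarrow> real"
  assumes F: "\<And>x. (F has_real_derivative f x) (at x)"
    and G: "\<And>x. (G has_real_derivative g x) (at x)"
    and u: "u \<in> {0..<1}"
  shows "((\<lambda>v. f v * G (frac (u - v)) - F v * g (frac (u - v))) has_integral
            (F 1 - F 0) * G u - F u * (G 1 - G 0)) {0..1}"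
    (is "(?h has_integral _) _")
proof -
  have D: "((\<lambda>v. F v * G (u - v + c)) has_vector_derivative
              f v * G (u - v + c) - F v * g (u - v + c)) (at v)" for v c
    unfolding has_real_derivative_iff_has_vector_derivative[symmetric]
    by (rule derivative_eq_intros DERIV_chain2[OF F] DERIV_chain2[OF G] refl | simp)+
  have cont: "continuous_on A (\<lambda>v. F v * G (u - v + c))" for A c
    by (intro continuous_at_imp_continuous_on ballI has_vector_derivative_continuous[OF D])
  have "(?h has_integral F u * G (u - u + 0) - F 0 * G (u - 0 + 0)) {0..u}"
  proof (rule fundamental_theorem_of_calculus_interior)
    fix v assume "v \<in> {0<..<u}"
    hence "frac (u - v) = u - v" using u by (simp add: frac_eq)
    thus "((\<lambda>v. F v * G (u - v + 0)) has_vector_derivative ?h v) (at v)"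
      using D[of 0 v] by simp
  qed (use u cont in \<open>simp_all del: add_0_right\<close>)
  moreover have "(?h has_integral F 1 * G (u - 1 + 1) - F u * G (u - u + 1)) {u..1}"
  proof (rule fundamental_theorem_of_calculus_interior)
    fix v assume "v \<in> {u<..<1}"
    hence "frac (u - v) = u - v + 1" using u
      by (subst frac_unique_iff) auto
    thus "((\<lambda>v. F v * G (u - v + 1)) has_vector_derivative ?h v) (at v)"
      using D[of 1 v] by simp
  qed (use u cont in auto)
  ultimately have "(?h has_integral (F u * G (u - u + 0) - F 0 * G (u - 0 + 0))
                      + (F 1 * G (u - 1 + 1) - F u * G (u - u + 1))) {0..1}"
    using u by (intro has_integral_combine) auto
  thus ?thesis by (simp add: algebra_simps)
qed

lemma has_integral_circ_conv_bernpoly_normalized: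
  "((\<lambda>v. bernpoly_normalized n v * bernpoly_normalized m (frac (u - v))) has_integral
      circ_conv (bernpoly_normalized n) (bernpoly_normalized m) u) {0..1}"
proof -
  let ?f = "\<lambda>v. bernpoly_normalized n v * bernpoly_normalized m (frac (u - v))"
  have "(?f has_integral circ_conv (bernpoly_normalized n) (bernpoly_normalized m) u) {0..<1}"
    unfolding circ_conv_def set_borel_integral_eq_integral(2)[OF circ_conv_integrable]
    by (rule integrable_integral[OF set_borel_integral_eq_integral(1)[OF circ_conv_integrable]])
  moreover have "negligible {v \<in> {0..<1} - {0..1}. ?f v \<noteq> 0}"
                "negligible {v \<in> {0..1} - {0..<1}. ?f v \<noteq> 0}"
    by (rule negligible_subset[of "{1}"]; auto)+
  ultimately show ?thesis
    by (simp only: has_integral_spike_set_eq[of "{0..<1}" "{0..1}"])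
qed

lemma circ_conv_bernpoly_normalized_shift:
  assumes "u \<in> {0..<1}"
  shows "circ_conv (bernpoly_normalized n) (bernpoly_normalized (Suc m)) u
           - circ_conv (bernpoly_normalized (Suc n)) (bernpoly_normalized m) u
         = of_bool (n = 0) * bernpoly_normalized (Suc m) u
           - of_bool (m = 0) * bernpoly_normalized (Suc n) u"
proof -
  note D = has_real_derivative_bernpoly_normalized
  have "circ_conv (bernpoly_normalized n) (bernpoly_normalized (Suc m)) u
           - circ_conv (bernpoly_normalized (Suc n)) (bernpoly_normalized m) u
        = (bernpoly_normalized (Suc n) 1 - bernpoly_normalized (Suc n) 0)
             * bernpoly_normalized (Suc m) u
          - bernpoly_normalized (Suc n) u
             * (bernpoly_normalized (Suc m) 1 - bernpoly_normalized (Suc m) 0)"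
    by (rule has_integral_unique[OF has_integral_diff[OF
              has_integral_circ_conv_bernpoly_normalized
              has_integral_circ_conv_bernpoly_normalized]
            circular_integration_by_parts[OF D D assms]])
  thus ?thesis by (simp add: bernpoly_normalized_jump)
qed

lemma circ_conv_bernpoly_normalized_0_left:
  assumes "u \<in> {0..<1}"
  shows "circ_conv (bernpoly_normalized 0) (bernpoly_normalized m) u = of_bool (m = 0)"
proof -
  \<comment> \<open>Integration by parts against the constant \<open>F = 1\<close> computes the mean of \<open>b\<^sub>m\<close>.\<close>
  have "((\<lambda>v. 0 * bernpoly_normalized (Suc m) (frac (u - v))
              - 1 * bernpoly_normalized m (frac (u - v))) has_integral
          (1 - 1) * bernpoly_normalized (Suc m) u
              - 1 * (bernpoly_normalized (Suc m) 1 - bernpoly_normalized (Suc m) 0)) {0..1}"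
    by (rule circular_integration_by_parts[OF _ has_real_derivative_bernpoly_normalized assms])
       simp
  from has_integral_neg[OF this]
  have "((\<lambda>v. bernpoly_normalized 0 v * bernpoly_normalized m (frac (u - v))) has_integral
          of_bool (m = 0)) {0..1}"
    by (simp add: bernpoly_normalized_0 bernpoly_normalized_jump)
  thus ?thesis
    using has_integral_circ_conv_bernpoly_normalized has_integral_unique by blast
qed

lemma circ_conv_bernpoly_normalized_Suc:
  assumes "u \<in> {0..<1}" "m \<ge> 1"
  shows "circ_conv (bernpoly_normalized (Suc n)) (bernpoly_normalized m) u
           = - bernpoly_normalized (Suc n + m) u"
  using assms(2)
proof (induction n arbitrary: m)
  case 0
  thus ?case
    using circ_conv_bernpoly_normalized_shift[OF assms(1), of 0 m]
    by (simp add: circ_conv_bernpoly_normalized_0_left[OF assms(1)])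
next
  case (Suc n)
  thus ?case
    using circ_conv_bernpoly_normalized_shift[OF assms(1), of "Suc n" m] Suc.IH[of "Suc m"]
    by simp
qed

theorem corollary1p2:
  shows "(\<forall>u\<in>{0..<1}. circ_conv (bernpoly_normalized 0) (bernpoly_normalized 0) u
                      = bernpoly_normalized 0 u) \<and>
         (\<forall>n\<ge>1. \<forall>u\<in>{0..<1}.
            circ_conv (bernpoly_normalized 0) (bernpoly_normalized n) u = 0) \<and>
         (\<forall>n\<ge>1. \<forall>m\<ge>1. \<forall>u\<in>{0..<1}.
            circ_conv (bernpoly_normalized n) (bernpoly_normalized m) u
              = - bernpoly_normalized (n + m) u)"
proof (intro conjI allI ballI impI)
  fix n m :: nat and u :: real
  assume "n \<ge> 1" "m \<ge> 1" "u \<in> {0..<1}"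
  moreover from \<open>n \<ge> 1\<close> obtain k where "n = Suc k" by (cases n) auto
  ultimately show "circ_conv (bernpoly_normalized n) (bernpoly_normalized m) u
                     = - bernpoly_normalized (n + m) u"
    using circ_conv_bernpoly_normalized_Suc by simp
qed (simp_all add: circ_conv_bernpoly_normalized_0_left bernpoly_normalized_0)

end
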